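(* Let $n \geq 2$, let $G_1,\ldots,G_n$ be vertex-disjoint graphs, and let $G$ be a vertex-gluing of $G_1,\ldots,G_n$ (i.e., $G$ is obtained from the disjoint union of $G_1,\ldots,G_n$ by choosing $u_i \in V(G_i)$ for each $i$ and identifying $u_1,\ldots,u_n$ as a single vertex). Then for every $m \in \mathbb{N}$, \[ P_{DP}(G,m) \leq \frac{\prod_{i=1}^{n} P_{DP}(G_i,m)}{m^{n-1}}. \]
   Context: All graphs are finite and simple. A cover of a graph $G$ is a pair $\mathcal{H}=(L,H)$ where $H$ is a graph and $L: V(G) \to \mathcal{P}(V(H))$ satisfies: (1) $\{L(u): u \in V(G)\}$ is a partition of $V(H)$ into $|V(G)|$ parts; (2) $H[L(u)]$ is complete for each $u$; (3) if there is an edge of $H$ between $L(u)$ and $L(v)$ with $u \neq v$, then $uv \in E(G)$; (4) if $uv \in E(G)$, the edges of $H$ between $L(u)$ and $L(v)$ form a (possibly empty) matching. The cover is $m$-fold if $|L(u)|=m$ for all $u$. An $\mathcal{H}$-coloring of $G$ is an independent set of $H$ of size $|V(G)|$. $P_{DP}(G,m)$ is the minimum number of $\mathcal{H}$-colorings of $G$ over all $m$-fold covers $\mathcal{H}$ of $G$. *)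

theory Defs
  imports Complex_Main "HOL-Library.Disjoint_Sets" "Graph_Theory.Graph_Theory"
begin

text \<open>
  A finite simple graph is a \<open>pair_graph\<close> of the library: a finite, loop-free, symmetric digraph
  whose arcs are ordered pairs. An undirected edge \<open>xy\<close> is represented by the two arcs
  \<open>(x, y)\<close> and \<open>(y, x)\<close>.
\<close>

definition edges_between :: "'b pair_pre_digraph \<Rightarrow> 'b set \<Rightarrow> 'b set \<Rightarrow> 'b set set" where
  "edges_between H A B = {{x, y} | x y. x \<in> A \<and> y \<in> B \<and> (x, y) \<in> parcs H}"

definition is_matching :: "'b set set \<Rightarrow> bool" where
  "is_matching M \<longleftrightarrow> (\<forall>e\<in>M. \<forall>f\<in>M. e \<noteq> f \<longrightarrow> e \<inter> f = {})"

definition independent_set :: "'b pair_pre_digraph \<Rightarrow> 'b set \<Rightarrow> bool" where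
  "independent_set H S \<longleftrightarrow> S \<subseteq> pverts H \<and> (\<forall>x\<in>S. \<forall>y\<in>S. (x, y) \<notin> parcs H)"

definition is_cover :: "'a pair_pre_digraph \<Rightarrow> ('a \<Rightarrow> 'b set) \<Rightarrow> 'b pair_pre_digraph \<Rightarrow> bool" where
  "is_cover G L H \<longleftrightarrow>
     pair_graph H \<and>
     partition_on (pverts H) (L ` pverts G) \<and> card (L ` pverts G) = card (pverts G) \<and>
     (\<forall>u\<in>pverts G. complete_digraph (card (L u)) (with_proj H \<restriction> L u)) \<and>
     (\<forall>u\<in>pverts G. \<forall>v\<in>pverts G.
        u \<noteq> v \<and> edges_between H (L u) (L v) \<noteq> {} \<longrightarrow> (u, v) \<in> parcs G) \<and>
     (\<forall>(u, v)\<in>parcs G. is_matching (edges_between H (L u) (L v)))"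

definition is_m_fold_cover ::
    "nat \<Rightarrow> 'a pair_pre_digraph \<Rightarrow> ('a \<Rightarrow> 'b set) \<Rightarrow> 'b pair_pre_digraph \<Rightarrow> bool" where
  "is_m_fold_cover m G L H \<longleftrightarrow> is_cover G L H \<and> (\<forall>u\<in>pverts G. card (L u) = m)"

definition cover_colorings :: "'a pair_pre_digraph \<Rightarrow> 'b pair_pre_digraph \<Rightarrow> 'b set set" where
  "cover_colorings G H = {S. independent_set H S \<and> card S = card (pverts G)}"

text \<open>
  Covers are taken with vertices in \<open>nat\<close>. As cover graphs are finite, this is no restriction:
  see \<open>P_DP_le\<close> below for covers over an arbitrary type, and \<open>P_DP_attained\<close> for the existence
  of the minimum when \<open>m \<ge> 1\<close>.
\<close>

definition P_DP :: "'a pair_pre_digraph \<Rightarrow> nat \<Rightarrow> nat" where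
  "P_DP G m = (LEAST k. \<exists>(L :: 'a \<Rightarrow> nat set) H.
     is_m_fold_cover m G L H \<and> k = card (cover_colorings G H))"

text \<open>
  The map \<open>q\<close> is the quotient map from the disjoint union of the graphs onto \<open>G\<close>; it identifies
  exactly the chosen vertices \<open>u 1, \<dots>, u n\<close> with each other. Since the vertex type of \<open>G\<close> is
  arbitrary, this determines \<open>G\<close> up to the names of its vertices.
\<close>

definition is_vertex_gluing ::
    "nat \<Rightarrow> (nat \<Rightarrow> 'a pair_pre_digraph) \<Rightarrow> 'b pair_pre_digraph \<Rightarrow> bool" where
  "is_vertex_gluing n Gs G \<longleftrightarrow>
     (\<exists>u q. (\<forall>i\<in>{1..n}. u i \<in> pverts (Gs i)) \<and>
        (\<forall>x\<in>(\<Union>i\<in>{1..n}. pverts (Gs i)). \<forall>y\<in>(\<Union>i\<in>{1..n}. pverts (Gs i)).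
           q x = q y \<longleftrightarrow> x = y \<or> (x \<in> u ` {1..n} \<and> y \<in> u ` {1..n})) \<and>
        pverts G = q ` (\<Union>i\<in>{1..n}. pverts (Gs i)) \<and>
        parcs G = map_prod q q ` (\<Union>i\<in>{1..n}. parcs (Gs i)))"

lemma pair_graph_iff:
  "pair_graph H \<longleftrightarrow> finite (pverts H) \<and> parcs H \<subseteq> pverts H \<times> pverts H \<and> sym (parcs H) \<and>
     (\<forall>x. (x, x) \<notin> parcs H)"
proof
  assume "pair_graph H"
  then interpret pair_graph H .
  show "finite (pverts H) \<and> parcs H \<subseteq> pverts H \<times> pverts H \<and> sym (parcs H) \<and>
     (\<forall>x. (x, x) \<notin> parcs H)"
    using pair_finite_verts in_arcsD1 in_arcsD2 pair_sym_arcs no_loops'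
    by (fastforce simp: symmetric_def)
next
  assume A: "finite (pverts H) \<and> parcs H \<subseteq> pverts H \<times> pverts H \<and> sym (parcs H) \<and>
     (\<forall>x. (x, x) \<notin> parcs H)"
  then have "finite (parcs H)" by (meson finite_SigmaI finite_subset)
  with A show "pair_graph H"
    by unfold_locales (auto simp: symmetric_def)
qed

lemma complete_induced_iff:
  assumes "pair_graph H" "A \<subseteq> pverts H"
  shows "complete_digraph (card A) (with_proj H \<restriction> A) \<longleftrightarrow>
    (\<forall>x\<in>A. \<forall>y\<in>A. x \<noteq> y \<longrightarrow> (x, y) \<in> parcs H)"
proof -
  interpret pair_graph H by fact
  have wp: "with_proj H \<restriction> A = with_proj \<lparr>pverts = A, parcs = parcs H \<inter> A \<times> A\<rparr>"
    by (auto simp: with_proj_def induce_subgraph_def)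
  have "pair_graph \<lparr>pverts = A, parcs = parcs H \<inter> A \<times> A\<rparr>"
    using assms unfolding pair_graph_iff by (auto simp: sym_def intro: finite_subset)
  then have "graph (with_proj H \<restriction> A)"
    unfolding wp by (rule pair_graph.pair_graphD_graph)
  then show ?thesis
    using no_loops' unfolding complete_digraph_def wp by auto
qed

lemma is_vertex_gluing_pair_graph:
  assumes "\<And>i. i \<in> {1..n} \<Longrightarrow> pair_graph (Gs i)"
    and "disjoint_family_on (\<lambda>i. pverts (Gs i)) {1..n}"
    and "is_vertex_gluing n Gs G"
  shows "pair_graph G"
proof -
  obtain u q where u: "\<And>i. i \<in> {1..n} \<Longrightarrow> u i \<in> pverts (Gs i)"
    and q: "\<And>x y i j. \<lbrakk>i \<in> {1..n}; j \<in> {1..n}; x \<in> pverts (Gs i); y \<in> pverts (Gs j); q x = q y\<rbrakk>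
           \<Longrightarrow> x = y \<or> (x \<in> u ` {1..n} \<and> y \<in> u ` {1..n})"
    and V: "pverts G = q ` (\<Union>i\<in>{1..n}. pverts (Gs i))"
    and E: "parcs G = map_prod q q ` (\<Union>i\<in>{1..n}. parcs (Gs i))"
  proof -
    obtain u q where "\<forall>i\<in>{1..n}. u i \<in> pverts (Gs i)"
      and q: "\<forall>x\<in>(\<Union>i\<in>{1..n}. pverts (Gs i)). \<forall>y\<in>(\<Union>i\<in>{1..n}. pverts (Gs i)).
           q x = q y \<longleftrightarrow> x = y \<or> (x \<in> u ` {1..n} \<and> y \<in> u ` {1..n})"
      and "pverts G = q ` (\<Union>i\<in>{1..n}. pverts (Gs i))"
        "parcs G = map_prod q q ` (\<Union>i\<in>{1..n}. parcs (Gs i))"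
      using assms(3) unfolding is_vertex_gluing_def by (elim exE conjE)
    moreover have "x = y \<or> (x \<in> u ` {1..n} \<and> y \<in> u ` {1..n})"
      if "i \<in> {1..n}" "j \<in> {1..n}" "x \<in> pverts (Gs i)" "y \<in> pverts (Gs j)" "q x = q y" for x y i j
    proof -
      have "x \<in> (\<Union>i\<in>{1..n}. pverts (Gs i))" "y \<in> (\<Union>i\<in>{1..n}. pverts (Gs i))"
        using that by blast+
      with q that(5) show ?thesis by blast
    qed
    ultimately show thesis by (intro that) simp_all
  qed
  note g = assms(1)[unfolded pair_graph_iff]
  have uniq: "x = u i" if x: "i \<in> {1..n}" "x \<in> pverts (Gs i)" "x \<in> u ` {1..n}" for x i
  proof -
    obtain j where j: "j \<in> {1..n}" "x = u j" using x(3) by auto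
    then have "x \<in> pverts (Gs j)" using u by simp
    then have "i = j" using x(1,2) j(1) disjoint_family_onD[OF assms(2), of i j] by auto
    then show ?thesis using j(2) by simp
  qed
  have loop: "q x \<noteq> q y" if "i \<in> {1..n}" "(x, y) \<in> parcs (Gs i)" for x y i
  proof
    assume eq: "q x = q y"
    have xy: "x \<in> pverts (Gs i)" "y \<in> pverts (Gs i)" "x \<noteq> y" using g[OF that(1)] that(2) by auto
    then have "x \<in> u ` {1..n}" "y \<in> u ` {1..n}" using q[OF that(1) that(1) xy(1,2) eq] by simp_all
    then have "x = u i" "y = u i" using uniq[OF that(1)] xy(1,2) by (iprover+)
    then show False using xy(3) by simp
  qed
  have "sym (parcs G)" unfolding E
  proof (rule symI)
    fix a b assume "(a, b) \<in> map_prod q q ` (\<Union>i\<in>{1..n}. parcs (Gs i))"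
    then obtain i x y where i: "i \<in> {1..n}" "(x, y) \<in> parcs (Gs i)" "a = q x" "b = q y" by auto
    then have "(y, x) \<in> parcs (Gs i)" using g by (meson symD)
    then show "(b, a) \<in> map_prod q q ` (\<Union>i\<in>{1..n}. parcs (Gs i))" using i by force
  qed
  moreover have "finite (pverts G)" unfolding V using g by auto
  moreover have "parcs G \<subseteq> pverts G \<times> pverts G" unfolding V E using g by fastforce
  moreover have "\<forall>x. (x, x) \<notin> parcs G" unfolding E using loop by auto
  ultimately show ?thesis unfolding pair_graph_iff by blast
qed

lemma is_m_fold_cover_transport:
  fixes H :: "'b pair_pre_digraph" and f :: "'b \<Rightarrow> 'c"
  assumes c: "is_m_fold_cover m G L H" and G: "pair_graph G" and f: "inj_on f (pverts H)"
  defines "H' \<equiv> \<lparr>pverts = f ` pverts H, parcs = map_prod f f ` parcs H\<rparr>"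
  shows "is_m_fold_cover m G (\<lambda>u. f ` L u) H'"
    and "card (cover_colorings G H') = card (cover_colorings G H)"
proof -
  have H: "pair_graph H" and P: "partition_on (pverts H) (L ` pverts G)"
    and C: "card (L ` pverts G) = card (pverts G)"
    and K: "\<And>u. u \<in> pverts G \<Longrightarrow> complete_digraph (card (L u)) (with_proj H \<restriction> L u)"
    and E: "\<And>u v. \<lbrakk>u \<in> pverts G; v \<in> pverts G; u \<noteq> v; edges_between H (L u) (L v) \<noteq> {}\<rbrakk>
              \<Longrightarrow> (u, v) \<in> parcs G"
    and M: "\<And>u v. (u, v) \<in> parcs G \<Longrightarrow> is_matching (edges_between H (L u) (L v))"
    and m: "\<And>u. u \<in> pverts G \<Longrightarrow> card (L u) = m"
    using c unfolding is_m_fold_cover_def is_cover_def by auto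
  note Hg = H[unfolded pair_graph_iff] and Gg = G[unfolded pair_graph_iff]
  have LV: "L u \<subseteq> pverts H" if "u \<in> pverts G" for u
    using P that unfolding partition_on_def by blast
  have arc: "(f x, f y) \<in> parcs H' \<longleftrightarrow> (x, y) \<in> parcs H"
    if "x \<in> pverts H" "y \<in> pverts H" for x y
  proof
    assume "(f x, f y) \<in> parcs H'"
    then obtain a b where ab: "(a, b) \<in> parcs H" "f x = f a" "f y = f b" by (auto simp: H'_def)
    then have "x = a" "y = b" using Hg that f by (auto dest: inj_onD)
    then show "(x, y) \<in> parcs H" using ab by simp
  qed (force simp: H'_def)
  have H': "pair_graph H'" unfolding pair_graph_iff
  proof (intro conjI allI)
    show "finite (pverts H')" "parcs H' \<subseteq> pverts H' \<times> pverts H'" using Hg by (auto simp: H'_def)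
    show "sym (parcs H')" using Hg by (force simp: H'_def sym_def)
    fix x show "(x, x) \<notin> parcs H'"
    proof
      assume "(x, x) \<in> parcs H'"
      then obtain a b where "(a, b) \<in> parcs H" "f a = f b" by (auto simp: H'_def)
      then show False using Hg f by (metis SigmaD1 SigmaD2 inj_onD subsetD)
    qed
  qed
  have im: "(\<lambda>u. f ` L u) ` pverts G = (`) f ` (L ` pverts G)" by auto
  have inj: "inj_on ((`) f) (Pow (pverts H))"
    using f by (rule inj_on_image_Pow)
  have injL: "inj_on ((`) f) (L ` pverts G)"
    by (rule inj_on_subset[OF inj]) (use LV in auto)
  have P': "partition_on (pverts H') ((\<lambda>u. f ` L u) ` pverts G)"
  proof (rule partition_onI)
    show "\<Union> ((\<lambda>u. f ` L u) ` pverts G) = pverts H'"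
      using P unfolding partition_on_def H'_def by (simp add: image_UN[symmetric])
    show "{} \<notin> (\<lambda>u. f ` L u) ` pverts G"
      using P unfolding partition_on_def by auto
    fix p p' assume pp: "p \<in> (\<lambda>u. f ` L u) ` pverts G" "p' \<in> (\<lambda>u. f ` L u) ` pverts G" "p \<noteq> p'"
    then obtain u v where uv: "u \<in> pverts G" "v \<in> pverts G" "p = f ` L u" "p' = f ` L v" by auto
    then have "L u \<noteq> L v" using pp(3) by auto
    then have "L u \<inter> L v = {}"
      using uv(1,2) P unfolding partition_on_def disjoint_def by simp
    then show "disjnt p p'" unfolding disjnt_def uv
      using inj_on_image_Int[OF f LV[OF uv(1)] LV[OF uv(2)]] by simp
  qed
  have K': "complete_digraph (card (f ` L u)) (with_proj H' \<restriction> (f ` L u))" if u: "u \<in> pverts G" for u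
  proof -
    have "f ` L u \<subseteq> pverts H'" using LV[OF u] by (auto simp: H'_def)
    moreover have "\<forall>x\<in>L u. \<forall>y\<in>L u. x \<noteq> y \<longrightarrow> (x, y) \<in> parcs H"
      using K[OF u] complete_induced_iff[OF H LV[OF u]] by simp
    ultimately show ?thesis
      using complete_induced_iff[OF H'] arc LV[OF u] by (auto simp: subset_iff)
  qed
  have EB: "edges_between H' (f ` L u) (f ` L v) = (`) f ` edges_between H (L u) (L v)"
    if uv: "u \<in> pverts G" "v \<in> pverts G" for u v
  proof -
    have "edges_between H' (f ` L u) (f ` L v) =
      {{f x, f y} | x y. x \<in> L u \<and> y \<in> L v \<and> (f x, f y) \<in> parcs H'}"
      unfolding edges_between_def by blast
    also have "\<dots> = {{f x, f y} | x y. x \<in> L u \<and> y \<in> L v \<and> (x, y) \<in> parcs H}"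
      using arc LV[OF uv(1)] LV[OF uv(2)] by blast
    also have "\<dots> = {f ` {x, y} | x y. x \<in> L u \<and> y \<in> L v \<and> (x, y) \<in> parcs H}"
      by simp
    also have "\<dots> = (`) f ` edges_between H (L u) (L v)"
      unfolding edges_between_def by blast
    finally show ?thesis .
  qed
  have ebV: "e \<subseteq> pverts H" if "e \<in> edges_between H A B" for e A B
    using that Hg unfolding edges_between_def by auto
  have M': "is_matching (edges_between H' (f ` L u) (f ` L v))" if uv: "(u, v) \<in> parcs G" for u v
  proof -
    have "f ` e \<inter> f ` e' = {}"
      if e: "e \<in> edges_between H (L u) (L v)" "e' \<in> edges_between H (L u) (L v)" "f ` e \<noteq> f ` e'"
      for e e'
    proof -
      have "e \<inter> e' = {}" using M[OF uv] e unfolding is_matching_def by blast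
      then show ?thesis using inj_on_image_Int[OF f ebV[OF e(1)] ebV[OF e(2)]] by simp
    qed
    moreover have "u \<in> pverts G" "v \<in> pverts G" using Gg uv by auto
    ultimately show ?thesis unfolding is_matching_def by (simp add: EB)
  qed
  show "is_m_fold_cover m G (\<lambda>u. f ` L u) H'"
    unfolding is_m_fold_cover_def is_cover_def
  proof (intro conjI ballI impI)
    show "card ((\<lambda>u. f ` L u) ` pverts G) = card (pverts G)"
      unfolding im using card_image[OF injL] C by simp
    show "card (f ` L u) = m" if "u \<in> pverts G" for u
      using card_image[OF inj_on_subset[OF f LV[OF that]]] m[OF that] by simp
    show "(u, v) \<in> parcs G" if "u \<in> pverts G" "v \<in> pverts G"
      "u \<noteq> v \<and> edges_between H' (f ` L u) (f ` L v) \<noteq> {}" for u v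
      using that E EB by auto
  qed (use H' P' K' M' in auto)
  have "cover_colorings G H' = (`) f ` cover_colorings G H"
  proof (intro set_eqI iffI)
    fix S assume "S \<in> cover_colorings G H'"
    then have S: "S \<subseteq> f ` pverts H" "\<forall>x\<in>S. \<forall>y\<in>S. (x, y) \<notin> parcs H'" "card S = card (pverts G)"
      unfolding cover_colorings_def independent_set_def by (auto simp: H'_def)
    then obtain T where T: "T \<subseteq> pverts H" "S = f ` T" by (auto simp: subset_image_iff)
    then have "card T = card (pverts G)"
      using card_image[OF inj_on_subset[OF f T(1)]] S(3) by simp
    moreover have "\<forall>x\<in>T. \<forall>y\<in>T. (x, y) \<notin> parcs H" using arc T S(2) by blast
    ultimately show "S \<in> (`) f ` cover_colorings G H"
      using T unfolding cover_colorings_def independent_set_def by blast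
  next
    fix S assume "S \<in> (`) f ` cover_colorings G H"
    then obtain T where T: "S = f ` T" "T \<subseteq> pverts H" "\<forall>x\<in>T. \<forall>y\<in>T. (x, y) \<notin> parcs H"
      "card T = card (pverts G)"
      unfolding cover_colorings_def independent_set_def by auto
    have "card S = card (pverts G)"
      using card_image[OF inj_on_subset[OF f T(2)]] T by simp
    moreover have "\<forall>x\<in>S. \<forall>y\<in>S. (x, y) \<notin> parcs H'" using arc T by blast
    moreover have "S \<subseteq> pverts H'" using T by (auto simp: H'_def)
    ultimately show "S \<in> cover_colorings G H'"
      unfolding cover_colorings_def independent_set_def by blast
  qed
  moreover have "inj_on ((`) f) (cover_colorings G H)"
    by (rule inj_on_subset[OF inj]) (auto simp: cover_colorings_def independent_set_def)
  ultimately show "card (cover_colorings G H') = card (cover_colorings G H)"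
    by (simp add: card_image)
qed

lemma nat_cover_of_cover:
  fixes H :: "'b pair_pre_digraph"
  assumes "pair_graph G" and c: "is_m_fold_cover m G L H"
  obtains L' :: "'a \<Rightarrow> nat set" and H' where "is_m_fold_cover m G L' H'"
    "card (cover_colorings G H') = card (cover_colorings G H)"
proof -
  have "finite (pverts H)"
    using c unfolding is_m_fold_cover_def is_cover_def pair_graph_iff by blast
  then obtain f :: "'b \<Rightarrow> nat" where "inj_on f (pverts H)"
    using finite_imp_inj_to_nat_seg[of "pverts H"] by metis
  from is_m_fold_cover_transport[OF c assms(1) this] show thesis by (rule that)
qed

lemma P_DP_le:
  fixes H :: "'b pair_pre_digraph"
  assumes "pair_graph G" and "is_m_fold_cover m G L H"
  shows "P_DP G m \<le> card (cover_colorings G H)"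
proof -
  obtain L' :: "'a \<Rightarrow> nat set" and H' where "is_m_fold_cover m G L' H'"
    and "card (cover_colorings G H) = card (cover_colorings G H')"
    using nat_cover_of_cover[OF assms] by (metis (no_types))
  then show ?thesis unfolding P_DP_def by (intro Least_le exI conjI)
qed

lemma m_fold_cover_exists:
  fixes G :: "'a pair_pre_digraph"
  assumes G: "pair_graph G" and m: "m \<ge> 1"
  shows "is_m_fold_cover m G (\<lambda>u. {u} \<times> {..<m})
    \<lparr>pverts = pverts G \<times> {..<m}, parcs = {((u, i), (u, j)) | u i j. u \<in> pverts G \<and> i < m \<and> j < m \<and> i \<noteq> j}\<rparr>"
    (is "is_m_fold_cover m G ?L ?H")
proof -
  have H: "pair_graph ?H" using G unfolding pair_graph_iff by (auto simp: sym_def)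
  have P: "partition_on (pverts ?H) (?L ` pverts G)"
  proof (rule partition_onI)
    show "{} \<notin> ?L ` pverts G" 
    proof
      assume "{} \<in> ?L ` pverts G"
      then obtain u where u: "{} = ?L u" by blast
      have "(u, 0) \<in> ?L u" using m by auto
      then show False unfolding u[symmetric] by simp
    qed
  qed (auto simp: disjnt_def)
  have "inj_on ?L (pverts G)"
  proof (rule inj_onI)
    fix u v assume "?L u = ?L v"
    moreover have "(u, 0) \<in> ?L u" using m by auto
    ultimately have "(u, 0) \<in> ?L v" by simp
    then show "u = v" by simp
  qed
  then have C: "card (?L ` pverts G) = card (pverts G)" by (rule card_image)
  have K: "complete_digraph (card (?L u)) (with_proj ?H \<restriction> ?L u)" if "u \<in> pverts G" for u
    using that by (subst complete_induced_iff[OF H]) auto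
  have E: "edges_between ?H (?L u) (?L v) = {}" if "u \<noteq> v" for u v
    using that unfolding edges_between_def by auto
  have "is_matching (edges_between ?H (?L u) (?L v))" if "(u, v) \<in> parcs G" for u v
  proof -
    have "u \<noteq> v" using G that unfolding pair_graph_iff by blast
    then show ?thesis using E by (simp add: is_matching_def)
  qed
  moreover have "card (?L u) = m" for u by (simp add: card_cartesian_product)
  ultimately show ?thesis
    unfolding is_m_fold_cover_def is_cover_def using H P C K E by blast
qed

lemma P_DP_attained:
  fixes G :: "'a pair_pre_digraph"
  assumes "pair_graph G" and "m \<ge> 1"
  obtains L :: "'a \<Rightarrow> nat set" and H where "is_m_fold_cover m G L H"
    "P_DP G m = card (cover_colorings G H)"
proof -
  obtain L' :: "'a \<Rightarrow> nat set" and H' where "is_m_fold_cover m G L' H'"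
    using nat_cover_of_cover[OF assms(1) m_fold_cover_exists[OF assms]] .
  then have "\<exists>k (L :: 'a \<Rightarrow> nat set) H. is_m_fold_cover m G L H \<and> k = card (cover_colorings G H)"
    by blast
  from LeastI_ex[OF this] show thesis unfolding P_DP_def[symmetric] using that by blast
qed

end

theory Submission
  imports Defs
begin

text \<open>
  Relabel an optimal cover \<open>H i\<close> of each \<open>Gs i\<close> so that its vertices are the pairs \<open>(x, c)\<close> with
  \<open>c < m\<close>, and let \<open>N i a\<close> be the number of its colorings that give \<open>u i\<close> the color \<open>a\<close>. Any shifts
  \<open>s i\<close> of the colors modulo \<open>m\<close> allow the covers to be glued along the fibres over the \<open>u i\<close>; the
  glued cover has at most \<open>\<Sum>c<m. \<Prod>i. N i ((c + s i) mod m)\<close> colorings. Summed over all \<open>m ^ n\<close>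
  choices of \<open>s\<close> this bound is \<open>m * (\<Prod>i. \<Sum>a<m. N i a) = m * (\<Prod>i. P_DP (Gs i) m)\<close>, so some choice of
  shifts does at least as well as the average.
\<close>

section \<open>Covers with fibres \<open>{u} \<times> {..<m}\<close>\<close>

lemma is_m_fold_cover_cong:
  assumes "\<And>u. u \<in> pverts G \<Longrightarrow> L u = L' u" and "pair_graph G"
  shows "is_m_fold_cover m G L H \<longleftrightarrow> is_m_fold_cover m G L' H"
proof -
  have "L ` pverts G = L' ` pverts G" using assms(1) by auto
  moreover have "u \<in> pverts G" "v \<in> pverts G" if "(u, v) \<in> parcs G" for u v
    using that assms(2) unfolding pair_graph_iff by auto
  ultimately show ?thesis
    unfolding is_m_fold_cover_def is_cover_def using assms(1)
    by (smt (verit, ccfv_SIG) case_prodD case_prodI2)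
qed

text \<open>With the fibres fixed, only the arcs of a cover remain to be chosen. All fibres carry
  the same colors, so fibres over different graphs can be matched up by permutations of
  \<open>{..<m}\<close>.\<close>

definition std_cover :: "nat \<Rightarrow> 'a pair_pre_digraph \<Rightarrow> ('a \<times> nat) pair_pre_digraph \<Rightarrow> bool" where
  "std_cover m G H \<longleftrightarrow> is_m_fold_cover m G (\<lambda>u. {u} \<times> {..<m}) H"

text \<open>Since \<open>u \<noteq> v\<close>, an edge between the two fibres has exactly one end in
  each. Two such edges meet iff they share the color over \<open>u\<close> or the color over
  \<open>v\<close>, and they coincide iff they share both.\<close>

lemma is_matching_edges_between_fibres:
  assumes "u \<noteq> v"
  shows "is_matching (edges_between H ({u} \<times> {..<m}) ({v} \<times> {..<m})) \<longleftrightarrow>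
    (\<forall>c<m. \<forall>d<m. \<forall>c'<m. \<forall>d'<m. ((u, c), (v, d)) \<in> parcs H \<longrightarrow> ((u, c'), (v, d')) \<in> parcs H \<longrightarrow>
      (c = c' \<longleftrightarrow> d = d'))" (is "?M \<longleftrightarrow> ?R")
proof
  assume M: ?M
  show ?R
  proof (intro allI impI)
    fix c d c' d'
    assume *: "c < m" "d < m" "c' < m" "d' < m"
      and e: "((u, c), (v, d)) \<in> parcs H" "((u, c'), (v, d')) \<in> parcs H"
    have "{(u, c), (v, d)} \<in> edges_between H ({u} \<times> {..<m}) ({v} \<times> {..<m})"
      "{(u, c'), (v, d')} \<in> edges_between H ({u} \<times> {..<m}) ({v} \<times> {..<m})"
      unfolding edges_between_def using * e by blast+
    then have "{(u, c), (v, d)} = {(u, c'), (v, d')} \<or> {(u, c), (v, d)} \<inter> {(u, c'), (v, d')} = {}"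
      using M[unfolded is_matching_def, rule_format] by (simp only: disj_imp) simp
    then show "c = c' \<longleftrightarrow> d = d'" using assms by (auto simp: doubleton_eq_iff)
  qed
next
  assume R: ?R
  show ?M unfolding is_matching_def
  proof (intro ballI impI)
    fix e f
    assume e: "e \<in> edges_between H ({u} \<times> {..<m}) ({v} \<times> {..<m})"
      and f: "f \<in> edges_between H ({u} \<times> {..<m}) ({v} \<times> {..<m})" and ne: "e \<noteq> f"
    obtain c d where e': "e = {(u, c), (v, d)}" "c < m" "d < m" "((u, c), (v, d)) \<in> parcs H"
      using e unfolding edges_between_def by auto
    obtain c' d' where f': "f = {(u, c'), (v, d')}" "c' < m" "d' < m" "((u, c'), (v, d')) \<in> parcs H"
      using f unfolding edges_between_def by auto
    have "c = c' \<longleftrightarrow> d = d'" using R e' f' by blast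
    then show "e \<inter> f = {}" using ne e'(1) f'(1) assms by auto
  qed
qed

text \<open>All clauses of a cover become conditions on single arcs. The matching clause is stated
  in one direction, as uniqueness of the partner over \<open>v\<close>; symmetry of the arcs gives
  the other direction. \<open>m \<ge> 1\<close> makes the fibres nonempty, as
  \<open>partition_on\<close> demands, and pairwise distinct.\<close>

lemma std_cover_iff:
  assumes G: "pair_graph G" and m: "m \<ge> 1"
  shows "std_cover m G H \<longleftrightarrow>
    pverts H = pverts G \<times> {..<m} \<and> parcs H \<subseteq> pverts H \<times> pverts H \<and> sym (parcs H) \<and>
    (\<forall>x. (x, x) \<notin> parcs H) \<and>
    (\<forall>u\<in>pverts G. \<forall>c<m. \<forall>d<m. c \<noteq> d \<longrightarrow> ((u, c), (u, d)) \<in> parcs H) \<and>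
    (\<forall>u c v d. ((u, c), (v, d)) \<in> parcs H \<longrightarrow> u \<noteq> v \<longrightarrow> (u, v) \<in> parcs G) \<and>
    (\<forall>u c v d d'. ((u, c), (v, d)) \<in> parcs H \<longrightarrow> ((u, c), (v, d')) \<in> parcs H \<longrightarrow> u \<noteq> v \<longrightarrow> d = d')"
    (is "_ \<longleftrightarrow> ?R")
proof
  let ?L = "\<lambda>u. {u} \<times> {..<m}"
  assume "std_cover m G H"
  then have H: "pair_graph H" and P: "partition_on (pverts H) (?L ` pverts G)"
    and K: "\<And>u. u \<in> pverts G \<Longrightarrow> complete_digraph (card (?L u)) (with_proj H \<restriction> ?L u)"
    and E: "\<And>u v. \<lbrakk>u \<in> pverts G; v \<in> pverts G; u \<noteq> v; edges_between H (?L u) (?L v) \<noteq> {}\<rbrakk>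
              \<Longrightarrow> (u, v) \<in> parcs G"
    and M: "\<And>u v. (u, v) \<in> parcs G \<Longrightarrow> is_matching (edges_between H (?L u) (?L v))"
    unfolding std_cover_def is_m_fold_cover_def is_cover_def by auto
  note Hg = H[unfolded pair_graph_iff]
  have V: "pverts H = pverts G \<times> {..<m}" using partition_onD1[OF P] by auto
  have "((u, c), (u, d)) \<in> parcs H" if "u \<in> pverts G" "c < m" "d < m" "c \<noteq> d" for u c d
    using K[OF that(1)] that complete_induced_iff[OF H, of "?L u"] by (auto simp: V)
  moreover have arc: "(u, v) \<in> parcs G" if "((u, c), (v, d)) \<in> parcs H" "u \<noteq> v" for u c v d
  proof (rule E)
    have *: "(u, c) \<in> ?L u" "(v, d) \<in> ?L v" "u \<in> pverts G" "v \<in> pverts G" using that(1) Hg V by auto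
    then show "u \<in> pverts G" "v \<in> pverts G" by auto
    have "{(u, c), (v, d)} \<in> edges_between H (?L u) (?L v)"
      unfolding edges_between_def using * that(1) by blast
    then show "edges_between H (?L u) (?L v) \<noteq> {}" by blast
  qed fact
  moreover have "d = d'"
    if "((u, c), (v, d)) \<in> parcs H" "((u, c), (v, d')) \<in> parcs H" "u \<noteq> v" for u c v d d'
  proof -
    have "c < m" "d < m" "d' < m" using that Hg V by auto
    then show ?thesis
      using M[OF arc[OF that(1,3)]] that unfolding is_matching_edges_between_fibres[OF that(3)] by blast
  qed
  ultimately show ?R using Hg V by blast
next
  let ?L = "\<lambda>u. {u} \<times> {..<m}"
  assume R: ?R
  then have V: "pverts H = pverts G \<times> {..<m}" by blast
  have H: "pair_graph H" using R G unfolding pair_graph_iff by auto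
  \<comment> \<open>The partition, the number of fibres and their size depend on the vertex set
    alone, so they are read off from the cover that has no arcs between different fibres.\<close>
  note ex = m_fold_cover_exists[OF G m, unfolded is_m_fold_cover_def is_cover_def]
  have M: "is_matching (edges_between H (?L u) (?L v))" if "(u, v) \<in> parcs G" for u v
  proof -
    have "u \<noteq> v" using that G unfolding pair_graph_iff by blast
    moreover have "c = c' \<longleftrightarrow> d = d'"
      if "((u, c), (v, d)) \<in> parcs H" "((u, c'), (v, d')) \<in> parcs H" for c d c' d'
    proof -
      \<comment> \<open>The reversed arcs yield the implication from \<open>d = d'\<close> to
        \<open>c = c'\<close>.\<close>
      have "((v, d), (u, c)) \<in> parcs H" "((v, d'), (u, c')) \<in> parcs H" using that R by (meson symD)+
      then show ?thesis using R that \<open>u \<noteq> v\<close> by metis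
    qed
    ultimately show ?thesis by (subst is_matching_edges_between_fibres) auto
  qed
  have K: "complete_digraph (card (?L u)) (with_proj H \<restriction> ?L u)" if "u \<in> pverts G" for u
  proof (subst complete_induced_iff[OF H])
    show "?L u \<subseteq> pverts H" using that V by auto
    show "\<forall>x\<in>?L u. \<forall>y\<in>?L u. x \<noteq> y \<longrightarrow> (x, y) \<in> parcs H" using R that by auto
  qed
  have E: "(u, v) \<in> parcs G" if "u \<noteq> v" "edges_between H (?L u) (?L v) \<noteq> {}" for u v
    using that R unfolding edges_between_def by blast
  show "std_cover m G H"
    unfolding std_cover_def is_m_fold_cover_def is_cover_def
    using H V ex M K E by auto
qed

text \<open>Number each fibre by \<open>{..<m}\<close> and send a vertex of \<open>H\<close> to the
  pair of its base vertex and its number. This map is injective, so the cover can be transported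
  along it.\<close>

lemma std_cover_of_cover:
  fixes H :: "'b pair_pre_digraph"
  assumes G: "pair_graph G" and c: "is_m_fold_cover m G L H"
  obtains H' where "std_cover m G H'" "card (cover_colorings G H') = card (cover_colorings G H)"
proof -
  have H: "pair_graph H" and P: "partition_on (pverts H) (L ` pverts G)"
    and C: "card (L ` pverts G) = card (pverts G)" and m: "\<And>u. u \<in> pverts G \<Longrightarrow> card (L u) = m"
    using c unfolding is_m_fold_cover_def is_cover_def by auto
  have fin: "finite (pverts H)" "finite (pverts G)" using H G unfolding pair_graph_iff by auto
  \<comment> \<open>There are as many parts as vertices of \<open>G\<close>, so \<open>L\<close> is
    injective. As the parts are disjoint, each vertex of \<open>H\<close> then lies over a single
    vertex of \<open>G\<close>, which makes \<open>r\<close> below well defined.\<close>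
  have inj: "inj_on L (pverts G)" using C fin(2) by (simp add: eq_card_imp_inj_on)
  have LV: "\<Union> (L ` pverts G) = pverts H" using partition_onD1[OF P] by simp
  have disj: "u = v" if "u \<in> pverts G" "v \<in> pverts G" "x \<in> L u" "x \<in> L v" for u v x
  proof -
    have "L u = L v" using disjointD[OF partition_onD2[OF P], of "L u" "L v"] that by blast
    then show ?thesis using inj that(1,2) by (simp add: inj_on_eq_iff)
  qed
  have "\<exists>b. bij_betw b (L u) {..<m}" if "u \<in> pverts G" for u
  proof -
    have "finite (L u)" using that LV fin(1) by (auto intro: finite_subset)
    then show ?thesis using m[OF that] by (metis bij_betw_iff_card card_lessThan finite_lessThan)
  qed
  then obtain b where b: "\<And>u. u \<in> pverts G \<Longrightarrow> bij_betw (b u) (L u) {..<m}" by metis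
  define r where "r x = (THE u. u \<in> pverts G \<and> x \<in> L u)" for x
  have r: "r x = u" if "u \<in> pverts G" "x \<in> L u" for u x
    unfolding r_def using that disj by blast
  define f where "f x = (r x, b (r x) x)" for x
  have f: "inj_on f (pverts H)"
  proof (rule inj_onI)
    fix x y assume xy: "x \<in> pverts H" "y \<in> pverts H" "f x = f y"
    then obtain u v where uv: "u \<in> pverts G" "x \<in> L u" "v \<in> pverts G" "y \<in> L v"
      using LV by blast
    then have "u = v" "b u x = b v y" using xy(3) r unfolding f_def by auto
    then show "x = y" using uv b[OF uv(1)] by (auto simp: bij_betw_def dest: inj_onD)
  qed
  have fL: "f ` L u = {u} \<times> {..<m}" if "u \<in> pverts G" for u
  proof -
    have "f ` L u = (\<lambda>x. (u, b u x)) ` L u" using r[OF that] by (simp add: f_def)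
    also have "\<dots> = {u} \<times> b u ` L u" by auto
    finally show ?thesis using b[OF that] by (simp add: bij_betw_def)
  qed
  note t = is_m_fold_cover_transport[OF c G f]
  show thesis
    by (rule that[OF _ t(2)])
      (use t(1) in \<open>simp add: std_cover_def is_m_fold_cover_cong[OF fL G]\<close>)
qed

section \<open>Colorings of a standard cover as functions\<close>

text \<open>
  In a standard cover, an independent set of size \<open>card (pverts G)\<close> is the graph of a function.
\<close>

definition selections ::
    "nat \<Rightarrow> 'a pair_pre_digraph \<Rightarrow> ('a \<times> nat) pair_pre_digraph \<Rightarrow> ('a \<Rightarrow> nat) set" where
  "selections m G H = {\<phi> \<in> pverts G \<rightarrow>\<^sub>E {..<m}.
     \<forall>u\<in>pverts G. \<forall>v\<in>pverts G. ((u, \<phi> u), (v, \<phi> v)) \<notin> parcs H}"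

lemma finite_selections: "pair_graph G \<Longrightarrow> finite (selections m G H)"
  unfolding selections_def pair_graph_iff
  by (auto intro: finite_subset[OF _ finite_PiE[of "pverts G" "\<lambda>_. {..<m}"]])

text \<open>Fibres are cliques, so \<open>fst\<close> is injective on an independent set
  \<open>S\<close>; having \<open>card (pverts G)\<close> elements, \<open>S\<close> then meets
  every fibre. Since selections are extensional, each is determined by its graph.\<close>

lemma card_cover_colorings_std:
  assumes G: "pair_graph G" and m: "m \<ge> 1" and H: "std_cover m G H"
  shows "card (cover_colorings G H) = card (selections m G H)"
proof -
  let ?g = "\<lambda>\<phi>. (\<lambda>u. (u, \<phi> u)) ` pverts G"
  note R = H[unfolded std_cover_iff[OF G m]]
  have finG: "finite (pverts G)" using G unfolding pair_graph_iff by auto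
  have "inj_on ?g (selections m G H)"
  proof (rule inj_onI)
    fix \<phi> \<psi> assume *: "\<phi> \<in> selections m G H" "\<psi> \<in> selections m G H" "?g \<phi> = ?g \<psi>"
    have "\<phi> u = \<psi> u" if "u \<in> pverts G" for u
    proof -
      have "(u, \<phi> u) \<in> ?g \<psi>" using *(3) that by blast
      then show ?thesis by auto
    qed
    then show "\<phi> = \<psi>" using *(1,2) unfolding selections_def by (auto intro: PiE_ext)
  qed
  moreover have "?g ` selections m G H = cover_colorings G H"
  proof (intro equalityI subsetI)
    fix S assume "S \<in> ?g ` selections m G H"
    then obtain \<phi> where \<phi>: "\<phi> \<in> selections m G H" "S = ?g \<phi>" by blast
    have "card S = card (pverts G)" unfolding \<phi>(2) by (rule card_image) (simp add: inj_on_def)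
    then show "S \<in> cover_colorings G H"
      using \<phi> R unfolding cover_colorings_def independent_set_def selections_def by auto
  next
    fix S assume "S \<in> cover_colorings G H"
    then have S: "S \<subseteq> pverts G \<times> {..<m}" "\<And>x y. x \<in> S \<Longrightarrow> y \<in> S \<Longrightarrow> (x, y) \<notin> parcs H"
      "card S = card (pverts G)"
      using R unfolding cover_colorings_def independent_set_def by auto
    have uniq: "c = d" if "(u, c) \<in> S" "(u, d) \<in> S" for u c d
    proof -
      have "u \<in> pverts G" "c < m" "d < m" using that S(1) by auto
      then show ?thesis using R S(2)[OF that] by metis
    qed
    have injf: "inj_on fst S" using uniq by (auto simp: inj_on_def)
    have "fst ` S \<subseteq> pverts G" using S(1) by auto
    then have "fst ` S = pverts G"
      using card_subset_eq[OF finG] S(3) card_image[OF injf] by metis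
    then have "\<exists>c. (u, c) \<in> S" if "u \<in> pverts G" for u using that by force
    then obtain h where h: "\<And>u. u \<in> pverts G \<Longrightarrow> (u, h u) \<in> S" by metis
    let ?\<phi> = "restrict h (pverts G)"
    have "S = ?g ?\<phi>" using h S(1) uniq by (auto simp: image_iff)
    moreover have "?\<phi> \<in> selections m G H" unfolding selections_def using h S(1,2) by auto
    ultimately show "S \<in> ?g ` selections m G H" by blast
  qed
  ultimately show ?thesis using card_image by metis
qed

lemma P_DP_le_selections:
  assumes "pair_graph G" "m \<ge> 1" "std_cover m G H"
  shows "P_DP G m \<le> card (selections m G H)"
  using P_DP_le[OF assms(1) assms(3)[unfolded std_cover_def]] card_cover_colorings_std[OF assms] by simp

lemma P_DP_attained_selections:
  assumes "pair_graph G" "m \<ge> 1"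
  obtains H where "std_cover m G H" "P_DP G m = card (selections m G H)"
proof -
  obtain L :: "'a \<Rightarrow> nat set" and H where H: "is_m_fold_cover m G L H"
    "P_DP G m = card (cover_colorings G H)"
    using P_DP_attained[OF assms] .
  obtain H' where "std_cover m G H'" "card (cover_colorings G H') = card (cover_colorings G H)"
    using std_cover_of_cover[OF assms(1) H(1)] .
  then show thesis using that H(2) card_cover_colorings_std[OF assms] by simp
qed

section \<open>The cover of a gluing built from covers of its pieces\<close>

text \<open>
  The color \<open>c\<close> at a vertex \<open>q x\<close> of the gluing plays the role of the color \<open>\<sigma> i c\<close> at the vertex
  \<open>x\<close> of \<open>Gs i\<close>; the permutation \<open>\<sigma> i\<close> is applied over all of \<open>Gs i\<close>, not only over \<open>u i\<close>, which
  avoids a case distinction.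
\<close>

definition glued_cover :: "nat \<Rightarrow> nat \<Rightarrow> (nat \<Rightarrow> 'a pair_pre_digraph) \<Rightarrow> ('a \<Rightarrow> 'b) \<Rightarrow>
    (nat \<Rightarrow> ('a \<times> nat) pair_pre_digraph) \<Rightarrow> (nat \<Rightarrow> nat \<Rightarrow> nat) \<Rightarrow> 'b pair_pre_digraph \<Rightarrow>
    ('b \<times> nat) pair_pre_digraph" where
  "glued_cover m n Gs q H \<sigma> G = \<lparr>pverts = pverts G \<times> {..<m},
     parcs = {((v, c), (v, d)) | v c d. v \<in> pverts G \<and> c < m \<and> d < m \<and> c \<noteq> d} \<union>
       {((q x, c), (q y, d)) | i x y c d. i \<in> {1..n} \<and> (x, y) \<in> parcs (Gs i) \<and> c < m \<and> d < m \<and>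
          ((x, \<sigma> i c), (y, \<sigma> i d)) \<in> parcs (H i)}\<rparr>"

text \<open>\<open>n \<ge> 1\<close> provides the index 1, so that \<open>q (u 1)\<close> names the
  glued vertex.\<close>

locale vertex_gluing =
  fixes n m :: nat and Gs :: "nat \<Rightarrow> 'a pair_pre_digraph" and G :: "'b pair_pre_digraph"
    and u :: "nat \<Rightarrow> 'a" and q :: "'a \<Rightarrow> 'b"
  assumes n: "n \<ge> 1" and m: "m \<ge> 1"
    and Gs: "\<And>i. i \<in> {1..n} \<Longrightarrow> pair_graph (Gs i)" and G: "pair_graph G"
    and disj: "disjoint_family_on (\<lambda>i. pverts (Gs i)) {1..n}"
    and u: "\<And>i. i \<in> {1..n} \<Longrightarrow> u i \<in> pverts (Gs i)"
    and q: "\<And>i j x y. \<lbrakk>i \<in> {1..n}; j \<in> {1..n}; x \<in> pverts (Gs i); y \<in> pverts (Gs j)\<rbrakk> \<Longrightarrow>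
      q x = q y \<longleftrightarrow> x = y \<or> (x \<in> u ` {1..n} \<and> y \<in> u ` {1..n})"
    and V: "pverts G = q ` (\<Union>i\<in>{1..n}. pverts (Gs i))"
    and E: "parcs G = map_prod q q ` (\<Union>i\<in>{1..n}. parcs (Gs i))"
begin

lemma index_unique:
  "\<lbrakk>i \<in> {1..n}; j \<in> {1..n}; x \<in> pverts (Gs i); x \<in> pverts (Gs j)\<rbrakk> \<Longrightarrow> i = j"
  using disjoint_family_onD[OF disj, of i j] by blast

text \<open>By disjointness of the vertex sets, \<open>u i\<close> is the only one of the chosen
  vertices that lies in \<open>Gs i\<close>.\<close>

lemma q_eq_iff:
  assumes "i \<in> {1..n}" "j \<in> {1..n}" "x \<in> pverts (Gs i)" "y \<in> pverts (Gs j)"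
  shows "q x = q y \<longleftrightarrow> x = y \<or> (x = u i \<and> y = u j)"
proof -
  have "z = u k" if "k \<in> {1..n}" "z \<in> pverts (Gs k)" "z \<in> u ` {1..n}" for z k
    using that u index_unique by (metis imageE)
  then show ?thesis using q[OF assms] assms by blast
qed

lemma arc_verts:
  "\<lbrakk>i \<in> {1..n}; (x, y) \<in> parcs (Gs i)\<rbrakk> \<Longrightarrow> x \<in> pverts (Gs i) \<and> y \<in> pverts (Gs i) \<and> x \<noteq> y"
  using Gs unfolding pair_graph_iff by auto

text \<open>At most one end of an arc is a chosen vertex. The other end is not identified with
  anything, so it fixes the index, and then both ends. Hence the arcs between two fibres of the
  glued cover all come from one \<open>H i\<close>.\<close>

lemma arc_lift_unique:
  assumes i: "i \<in> {1..n}" "(x, y) \<in> parcs (Gs i)" and j: "j \<in> {1..n}" "(x', y') \<in> parcs (Gs j)"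
    and eq: "q x = q x'" "q y = q y'"
  shows "i = j \<and> x = x' \<and> y = y'"
proof -
  note vi = arc_verts[OF i] and vj = arc_verts[OF j]
  have "x = x' \<or> (x = u i \<and> x' = u j)" "y = y' \<or> (y = u i \<and> y' = u j)"
    using q_eq_iff[OF i(1) j(1)] vi vj eq by auto
  then have "i = j" using vi vj index_unique[OF i(1) j(1)] by metis
  then show ?thesis using \<open>x = x' \<or> _\<close> \<open>y = y' \<or> _\<close> by auto
qed

lemma q_arc_neq: "\<lbrakk>i \<in> {1..n}; (x, y) \<in> parcs (Gs i)\<rbrakk> \<Longrightarrow> q x \<noteq> q y"
  using q_eq_iff arc_verts by metis

context
  fixes H :: "nat \<Rightarrow> ('a \<times> nat) pair_pre_digraph" and \<sigma> :: "nat \<Rightarrow> nat \<Rightarrow> nat"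
  assumes H: "\<And>i. i \<in> {1..n} \<Longrightarrow> std_cover m (Gs i) (H i)"
    and \<sigma>: "\<And>i. i \<in> {1..n} \<Longrightarrow> bij_betw (\<sigma> i) {..<m} {..<m}"
begin

abbreviation "K \<equiv> glued_cover m n Gs q H \<sigma> G"

lemma glued_arc_same: "((v, c), (v, d)) \<in> parcs K \<longleftrightarrow> v \<in> pverts G \<and> c < m \<and> d < m \<and> c \<noteq> d"
  unfolding glued_cover_def using q_arc_neq by auto

lemma glued_arc_diff:
  assumes "v \<noteq> w"
  shows "((v, c), (w, d)) \<in> parcs K \<longleftrightarrow> (\<exists>i x y. i \<in> {1..n} \<and> (x, y) \<in> parcs (Gs i) \<and>
    v = q x \<and> w = q y \<and> c < m \<and> d < m \<and> ((x, \<sigma> i c), (y, \<sigma> i d)) \<in> parcs (H i))"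
  unfolding glued_cover_def using assms by auto

text \<open>Over each edge of \<open>G\<close> the arcs are those of a single \<open>H i\<close>,
  with colors renamed by the permutation \<open>\<sigma> i\<close>; renaming preserves
  matchings.\<close>

lemma std_cover_glued: "std_cover m G K"
proof -
  note R = std_cover_iff[OF Gs m, THEN iffD1, OF _ H]
  have lift: "(v, w) \<in> parcs G" if "((v, c), (w, d)) \<in> parcs K" "v \<noteq> w" for v c w d
    using that unfolding glued_arc_diff[OF that(2)] E by force
  have sub: "v \<in> pverts G \<and> c < m \<and> w \<in> pverts G \<and> d < m" if "((v, c), (w, d)) \<in> parcs K" for v c w d
  proof (cases "v = w")
    case True
    then show ?thesis using that glued_arc_same by blast
  next
    case False
    then have "(v, w) \<in> parcs G" using that lift by blast
    then show ?thesis using that glued_arc_diff[OF False] G unfolding pair_graph_iff by auto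
  qed
  have sym: "((w, d), (v, c)) \<in> parcs K" if e: "((v, c), (w, d)) \<in> parcs K" for v c w d
  proof (cases "v = w")
    case True
    then show ?thesis using e glued_arc_same by metis
  next
    case False
    obtain i x y where *: "i \<in> {1..n}" "(x, y) \<in> parcs (Gs i)" "v = q x" "w = q y"
      "c < m" "d < m" "((x, \<sigma> i c), (y, \<sigma> i d)) \<in> parcs (H i)"
      using e unfolding glued_arc_diff[OF False] by blast
    have "(y, x) \<in> parcs (Gs i)" using Gs[OF *(1)] *(2) unfolding pair_graph_iff by (meson symD)
    moreover have "((y, \<sigma> i d), (x, \<sigma> i c)) \<in> parcs (H i)" using R[OF *(1,1)] *(7) by (meson symD)
    ultimately show ?thesis unfolding glued_arc_diff[OF False[symmetric]] using * by blast
  qed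
  have match: "d = d'" if e: "((v, c), (w, d)) \<in> parcs K" "((v, c), (w, d')) \<in> parcs K" "v \<noteq> w"
    for v c w d d'
  proof -
    obtain i x y where *: "i \<in> {1..n}" "(x, y) \<in> parcs (Gs i)" "v = q x" "w = q y"
      "d < m" "((x, \<sigma> i c), (y, \<sigma> i d)) \<in> parcs (H i)"
      using e(1) unfolding glued_arc_diff[OF e(3)] by blast
    obtain i' x' y' where **: "i' \<in> {1..n}" "(x', y') \<in> parcs (Gs i')" "v = q x'" "w = q y'"
      "d' < m" "((x', \<sigma> i' c), (y', \<sigma> i' d')) \<in> parcs (H i')"
      using e(2) unfolding glued_arc_diff[OF e(3)] by blast
    \<comment> \<open>Both arcs lie over the same edge of \<open>G\<close>, so they have the same
      lift and the matching condition of \<open>H i\<close> applies to them.\<close>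
    have "i' = i" "x' = x" "y' = y" using arc_lift_unique[OF *(1,2) **(1,2)] *(3,4) **(3,4) by auto
    moreover have "x \<noteq> y" using arc_verts[OF *(1,2)] by simp
    ultimately have "\<sigma> i d = \<sigma> i d'" using R[OF *(1,1)] *(6) **(6) by metis
    then show ?thesis using \<sigma>[OF *(1)] *(5) **(5) by (auto simp: bij_betw_def dest: inj_onD)
  qed
  have "pverts K = pverts G \<times> {..<m}" by (simp add: glued_cover_def)
  moreover have "parcs K \<subseteq> pverts K \<times> pverts K"
    unfolding \<open>pverts K = _\<close> using sub by auto
  moreover have "sym (parcs K)" using sym by (auto intro: symI)
  moreover have "(z, z) \<notin> parcs K" for z using glued_arc_same by (cases z) simp
  ultimately show ?thesis
    unfolding std_cover_iff[OF G m] using glued_arc_same lift match by blast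
qed

text \<open>A selection of the gluing is determined by its pullbacks to the \<open>Gs i\<close>. If
  it has color \<open>c\<close> at the glued vertex, its pullback to \<open>Gs i\<close> is a
  selection of \<open>H i\<close> with color \<open>\<sigma> i c\<close> at
  \<open>u i\<close>.\<close>

lemma card_selections_glued_le:
  "card (selections m G K) \<le>
    (\<Sum>c<m. \<Prod>i\<in>{1..n}. card {\<psi> \<in> selections m (Gs i) (H i). \<psi> (u i) = \<sigma> i c})"
proof -
  note R = std_cover_iff[OF Gs m, THEN iffD1, OF _ H]
  let ?N = "\<lambda>c i. {\<psi> \<in> selections m (Gs i) (H i). \<psi> (u i) = \<sigma> i c}"
  \<comment> \<open>Recording the color \<open>c\<close> of the glued vertex makes the union over
    \<open>c\<close> disjoint, so that its cardinality is a sum of products.\<close>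
  let ?T = "SIGMA c:{..<m}. PiE {1..n} (?N c)"
  let ?pull = "\<lambda>\<phi>. \<lambda>i\<in>{1..n}. \<lambda>x\<in>pverts (Gs i). \<sigma> i (\<phi> (q x))"
  let ?F = "\<lambda>\<phi>. (\<phi> (q (u 1)), ?pull \<phi>)"
  have qV: "q x \<in> pverts G" if "i \<in> {1..n}" "x \<in> pverts (Gs i)" for i x unfolding V using that by blast
  have root: "q (u i) = q (u 1)" if "i \<in> {1..n}" for i
    using q_eq_iff[of i 1] that n u by auto
  have \<sigma>m: "\<sigma> i c < m" if "i \<in> {1..n}" "c < m" for i c
    using \<sigma>[OF that(1)] that(2) by (auto simp: bij_betw_def)
  have lt: "\<phi> v < m" if "\<phi> \<in> selections m G K" "v \<in> pverts G" for \<phi> v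
    using that unfolding selections_def by auto
  have fin: "finite (?N c i)" if "i \<in> {1..n}" for c i using finite_selections[OF Gs[OF that]] by simp
  have "inj_on ?F (selections m G K)"
  proof (rule inj_onI)
    fix \<phi> \<psi> assume *: "\<phi> \<in> selections m G K" "\<psi> \<in> selections m G K" "?F \<phi> = ?F \<psi>"
    have "\<phi> v = \<psi> v" if v: "v \<in> pverts G" for v
    proof -
      obtain i x where i: "i \<in> {1..n}" "x \<in> pverts (Gs i)" "v = q x" using v V by auto
      have "?pull \<phi> i x = ?pull \<psi> i x" using arg_cong[OF *(3), of snd] by (simp only: snd_conv)
      then have "\<sigma> i (\<phi> v) = \<sigma> i (\<psi> v)" using i by simp
      then show ?thesis using \<sigma>[OF i(1)] lt[OF *(1) v] lt[OF *(2) v]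
        by (auto simp: bij_betw_def dest: inj_onD)
    qed
    then show "\<phi> = \<psi>" using *(1,2) unfolding selections_def by (auto intro: PiE_ext)
  qed
  moreover have "?F ` selections m G K \<subseteq> ?T"
  proof (rule image_subsetI)
    fix \<phi> assume \<phi>: "\<phi> \<in> selections m G K"
    have "?pull \<phi> i \<in> ?N (\<phi> (q (u 1))) i" if i: "i \<in> {1..n}" for i
    proof -
      let ?\<psi> = "\<lambda>x\<in>pverts (Gs i). \<sigma> i (\<phi> (q x))"
      have "((x, ?\<psi> x), (y, ?\<psi> y)) \<notin> parcs (H i)"
        if xy: "x \<in> pverts (Gs i)" "y \<in> pverts (Gs i)" for x y
      proof
        assume a: "((x, ?\<psi> x), (y, ?\<psi> y)) \<in> parcs (H i)"
        \<comment> \<open>\<open>H i\<close> has no loops, so \<open>x \<noteq> y\<close>; an arc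
          between different fibres of \<open>H i\<close> lies over an arc of \<open>Gs i\<close>,
          and such an arc is copied into \<open>K\<close>.\<close>
        then have "x \<noteq> y" using R[OF i i] by metis
        then have arc: "(x, y) \<in> parcs (Gs i)" using R[OF i i] a by metis
        have "((q x, \<phi> (q x)), (q y, \<phi> (q y))) \<in> parcs K"
          using glued_arc_diff[OF q_arc_neq[OF i arc]] i arc a xy lt[OF \<phi> qV[OF i]] by auto
        then show False using \<phi> qV[OF i] xy unfolding selections_def by blast
      qed
      moreover have "?\<psi> \<in> pverts (Gs i) \<rightarrow>\<^sub>E {..<m}" using \<sigma>m[OF i] lt[OF \<phi> qV[OF i]] by auto
      moreover have "?\<psi> (u i) = \<sigma> i (\<phi> (q (u 1)))" using u[OF i] root[OF i] by simp
      ultimately show ?thesis using i unfolding selections_def by simp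
    qed
    moreover have "\<phi> (q (u 1)) < m" using lt[OF \<phi> qV[OF _ u]] n by simp
    ultimately show "?F \<phi> \<in> ?T" by (auto simp: PiE_iff)
  qed
  moreover have "finite ?T" using fin by (auto intro!: finite_PiE)
  ultimately have "card (selections m G K) \<le> card ?T" by (rule card_inj_on_le)
  also have "card ?T = (\<Sum>c<m. \<Prod>i\<in>{1..n}. card (?N c i))"
    using fin by (subst card_SigmaI) (auto intro!: finite_PiE simp: card_PiE)
  finally show ?thesis .
qed

end

end

section \<open>Averaging over all shifts modulo \<open>m\<close>\<close>

lemma bij_betw_add_mod: "bij_betw (\<lambda>c. (c + s) mod m) {..<m} {..<m::nat}"
proof -
  have inj: "inj_on (\<lambda>c. (c + s) mod m) {..<m}"
  proof (rule inj_onI)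
    fix c d assume cd: "c \<in> {..<m}" "d \<in> {..<m}" "(c + s) mod m = (d + s) mod m"
    \<comment> \<open>The congruence becomes an equation of natural numbers in which
      \<open>s\<close> cancels.\<close>
    then obtain k l where "c + m * k = d + m * l" by (auto simp: nat_mod_eq_iff)
    then have "(c + m * k) mod m = (d + m * l) mod m" by simp
    then show "c = d" using cd by simp
  qed
  moreover have "(\<lambda>c. (c + s) mod m) ` {..<m} \<subseteq> {..<m}" by auto
  ultimately show ?thesis unfolding bij_betw_def using endo_inj_surj by blast
qed

theorem theorem1p10:
  fixes n m :: nat and Gs :: "nat \<Rightarrow> 'a pair_pre_digraph" and G :: "'b pair_pre_digraph"
  assumes "n \<ge> 2"
    and "\<And>i. i \<in> {1..n} \<Longrightarrow> pair_graph (Gs i)"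
    and "disjoint_family_on (\<lambda>i. pverts (Gs i)) {1..n}"
    and "is_vertex_gluing n Gs G"
    and "m \<ge> 1"
  shows "real (P_DP G m) \<le> (\<Prod>i\<in>{1..n}. real (P_DP (Gs i) m)) / real m ^ (n - 1)"
proof -
  obtain u q where uq: "\<forall>i\<in>{1..n}. u i \<in> pverts (Gs i)"
    "\<forall>x\<in>(\<Union>i\<in>{1..n}. pverts (Gs i)). \<forall>y\<in>(\<Union>i\<in>{1..n}. pverts (Gs i)).
       q x = q y \<longleftrightarrow> x = y \<or> (x \<in> u ` {1..n} \<and> y \<in> u ` {1..n})"
    "pverts G = q ` (\<Union>i\<in>{1..n}. pverts (Gs i))"
    "parcs G = map_prod q q ` (\<Union>i\<in>{1..n}. parcs (Gs i))"
    using assms(4) unfolding is_vertex_gluing_def by (elim exE conjE)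
  have G: "pair_graph G" using is_vertex_gluing_pair_graph[OF assms(2-4)] by simp
  interpret vertex_gluing n m Gs G u q
  proof (rule vertex_gluing.intro)
    fix i j x y
    assume "i \<in> {1..n}" "j \<in> {1..n}" "x \<in> pverts (Gs i)" "y \<in> pverts (Gs j)"
    then have "x \<in> (\<Union>i\<in>{1..n}. pverts (Gs i))" "y \<in> (\<Union>i\<in>{1..n}. pverts (Gs i))" by blast+
    then show "q x = q y \<longleftrightarrow> x = y \<or> (x \<in> u ` {1..n} \<and> y \<in> u ` {1..n})" using uq(2) by blast
  next
    show "1 \<le> n" using assms(1) by linarith
  qed (use assms(3,5) uq(1) in \<open>simp_all add: assms(2) G uq(3,4)\<close>)
  have "\<exists>H. std_cover m (Gs i) H \<and> P_DP (Gs i) m = card (selections m (Gs i) H)"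
    if "i \<in> {1..n}" for i
    using P_DP_attained_selections[OF assms(2)[OF that] assms(5)] by metis
  then obtain H where H: "\<And>i. i \<in> {1..n} \<Longrightarrow> std_cover m (Gs i) (H i)"
    and PH: "\<And>i. i \<in> {1..n} \<Longrightarrow> P_DP (Gs i) m = card (selections m (Gs i) (H i))"
    by metis
  define N where "N i a = card {\<psi> \<in> selections m (Gs i) (H i). \<psi> (u i) = a}" for i a
  have sumN: "(\<Sum>a<m. N i a) = P_DP (Gs i) m" if i: "i \<in> {1..n}" for i
  proof -
    let ?S = "selections m (Gs i) (H i)"
    have "?S = (\<Union>a<m. {\<psi> \<in> ?S. \<psi> (u i) = a})" 
      using uq(1) i unfolding selections_def by (auto simp: PiE_iff)
    then have "card ?S = card (\<Union>a<m. {\<psi> \<in> ?S. \<psi> (u i) = a})" by simp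
    also have "\<dots> = (\<Sum>a<m. card {\<psi> \<in> ?S. \<psi> (u i) = a})"
      using finite_selections[OF assms(2)[OF i]] by (intro card_UN_disjoint) auto
    finally show ?thesis unfolding PH[OF i] N_def by simp
  qed
  let ?A = "{1..n} \<rightarrow>\<^sub>E {..<m}"
  \<comment> \<open>The permutation \<open>\<sigma> i\<close> is the shift by \<open>s i\<close>, so
    every family of shifts gives a valid glued cover.\<close>
  have bound: "P_DP G m \<le> (\<Sum>c<m. \<Prod>i\<in>{1..n}. N i ((c + s i) mod m))" for s
    using P_DP_le_selections[OF G m std_cover_glued[OF H bij_betw_add_mod]]
      card_selections_glued_le[OF H bij_betw_add_mod, of s]
    unfolding N_def by (meson order_trans)
  \<comment> \<open>There are \<open>m ^ n\<close> families of shifts in \<open>?A\<close>; summing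
    the bound over them avoids choosing a best one.\<close>
  have "m ^ n * P_DP G m = (\<Sum>s\<in>?A. P_DP G m)" by (simp add: card_PiE)
  also have "\<dots> \<le> (\<Sum>s\<in>?A. \<Sum>c<m. \<Prod>i\<in>{1..n}. N i ((c + s i) mod m))"
    by (intro sum_mono bound)
  also have "\<dots> = (\<Sum>c<m. \<Sum>s\<in>?A. \<Prod>i\<in>{1..n}. N i ((c + s i) mod m))" by (rule sum.swap)
  \<comment> \<open>The \<open>i\<close>-th factor depends on \<open>s\<close> only through
    \<open>s i\<close>, so the sum over all families distributes over the product.\<close>
  also have "\<dots> = (\<Sum>c<m. \<Prod>i\<in>{1..n}. \<Sum>j<m. N i ((c + j) mod m))"
    by (intro sum.cong refl prod_sum_PiE[symmetric]) auto
  \<comment> \<open>For fixed \<open>c\<close>, the color \<open>(c + j) mod m\<close> runs through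
    \<open>{..<m}\<close> once as \<open>j\<close> does, so each inner sum is the full count
    \<open>sumN\<close>, whatever \<open>c\<close> is.\<close>
  also have "\<dots> = (\<Sum>c<m. \<Prod>i\<in>{1..n}. P_DP (Gs i) m)"
  proof (intro sum.cong prod.cong refl)
    fix c i assume "i \<in> {1..n}"
    then show "(\<Sum>j<m. N i ((c + j) mod m)) = P_DP (Gs i) m"
      using sum.reindex_bij_betw[OF bij_betw_add_mod, of "N i" c m] sumN by (simp add: add.commute)
  qed
  also have "\<dots> = m * (\<Prod>i\<in>{1..n}. P_DP (Gs i) m)" by simp
  \<comment> \<open>The \<open>m\<close> equal summands leave one factor \<open>m\<close>, which
    cancels against \<open>m ^ n = m * m ^ (n - 1)\<close>; this uses \<open>n > 0\<close> and
    \<open>m > 0\<close>.\<close>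
  finally have "m ^ (n - 1) * P_DP G m \<le> (\<Prod>i\<in>{1..n}. P_DP (Gs i) m)"
    using assms(1,5) by (cases n) (auto simp: mult.assoc)
  then have "real m ^ (n - 1) * real (P_DP G m) \<le> (\<Prod>i\<in>{1..n}. real (P_DP (Gs i) m))"
    by (metis of_nat_le_iff of_nat_mult of_nat_power of_nat_prod)
  then show ?thesis using assms(5) by (simp add: field_simps)
qed

end
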